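(* Let $\{x^k\}$ be the sequence generated by the parameter-dependent generalized conditional gradient algorithm (PGM-CondG) described in the context. Then every limit point of $\{x^k\}$ is a Pareto critical point of the problem of minimizing $F=G+H$ over $\mathbb{R}^n$.
   Context: Let $m,n\ge 1$. For each $i\in\{1,\dots,m\}$ let $g_i:\mathbb{R}^n\to\mathbb{R}\cup\{+\infty\}$ be proper, convex and lower semicontinuous, let $h_i:\mathbb{R}^n\to\mathbb{R}$ be continuously differentiable, and set $f_i=g_i+h_i$, $F=(f_1,\dots,f_m)^\top$, $G=(g_1,\dots,g_m)^\top$, $H=(h_1,\dots,h_m)^\top$. Put $\mathrm{dom}(g_i)=\{x: g_i(x)<+\infty\}$ and $\mathrm{dom}(G)=\bigcap_i\mathrm{dom}(g_i)$; $\mathrm{dom}(G)$ is assumed nonempty, convex and compact. $\|\cdot\|$ is the Euclidean norm. Hölder assumption: there are $\nu\in(0,1]$ and $M_{i,\nu}>0$ with $\|\nabla h_i(x)-\nabla h_i(y)\|\le M_{i,\nu}\|x-y\|^\nu$ for all $x,y\in\mathrm{dom}(g_i)$, $i=1,\dots,m$; set $M_\nu=\max_i M_{i,\nu}$. For $x\in\mathrm{dom}(G)$ the gap function is $\theta(x)=\min_{u\in\mathbb{R}^n}\max_{1\le i\le m}\{g_i(u)-g_i(x)+\langle\nabla h_i(x),u-x\rangle\}$ (so $\theta(x)\le0$), and $s(x)\in\mathrm{dom}(G)$ denotes a chosen minimizer. A point $\bar x\in\mathrm{dom}(G)$ is Pareto critical (also called Pareto stationary) if $\max_{1\le i\le m}f_i'(\bar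 x;d)\ge0$ for all $d\in\mathbb{R}^n$, where $f_i'(\bar x;d)=\lim_{\lambda\downarrow0}\frac{f_i(\bar x+\lambda d)-f_i(\bar x)}{\lambda}$ is the directional derivative (with values in $[-\infty,+\infty]$). Algorithm PGM-CondG: start from $x^0\in\mathrm{dom}(G)$. At iteration $k=0,1,\dots$ compute $s(x^k)$ and $\theta(x^k)$; stop if $\theta(x^k)=0$; otherwise set $$t_k=\min\left\{1,\left(\frac{|\theta(x^k)|}{M_\nu\|s(x^k)-x^k\|^{1+\nu}}\right)^{1/\nu}\right\},\qquad x^{k+1}=x^k+t_k(s(x^k)-x^k).$$ The generated sequence is understood to be infinite, i.e. $\theta(x^k)\ne0$ for all $k$ (then $s(x^k)\neq x^k$). *)

theory Defs
  imports "HOL-Analysis.Analysis"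
begin

subsection \<open>Extended-real-valued functions\<close>

definition effdom :: "('a \<Rightarrow> ereal) \<Rightarrow> 'a set" where
  "effdom f = {x. f x < \<infinity>}"

text \<open>Properness includes that the value \<open>-\<infinity>\<close> is never taken, i.e. the function maps into
  the reals extended by \<open>+\<infinity>\<close> only.\<close>

definition proper_fun :: "('a \<Rightarrow> ereal) \<Rightarrow> bool" where
  "proper_fun f \<longleftrightarrow> (\<forall>x. f x \<noteq> -\<infinity>) \<and> effdom f \<noteq> {}"

definition convex_fun :: "('a::real_vector \<Rightarrow> ereal) \<Rightarrow> bool" where
  "convex_fun f \<longleftrightarrow>
     (\<forall>x y t. 0 < t \<and> t < 1 \<longrightarrow>
        f ((1 - t) *\<^sub>R x + t *\<^sub>R y) \<le> ereal (1 - t) * f x + ereal t * f y)"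

definition lsc_fun :: "('a::topological_space \<Rightarrow> ereal) \<Rightarrow> bool" where
  "lsc_fun f \<longleftrightarrow> (\<forall>x. f x \<le> Liminf (at x) f)"

text \<open>One-sided directional derivative, with values in the extended reals. \<open>Lim\<close> is
  meaningful only where the limit exists, as it does for a convex function plus a
  differentiable one at every point of the effective domain.\<close>

definition dir_deriv :: "('a::real_vector \<Rightarrow> ereal) \<Rightarrow> 'a \<Rightarrow> 'a \<Rightarrow> ereal" where
  "dir_deriv f x d = Lim (at_right 0) (\<lambda>r::real. (f (x + r *\<^sub>R d) - f x) / ereal r)"

subsection \<open>The composite multiobjective problem\<close>

text \<open>The number of objectives is the cardinality of the finite index type \<open>'m\<close>, the dimension
  of the space that of \<open>'n\<close>; both are at least one. A function \<open>dh i\<close> is the gradient of \<open>h i\<close>.\<close>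

definition domG :: "('m \<Rightarrow> 'a \<Rightarrow> ereal) \<Rightarrow> 'a set" where
  "domG g = (\<Inter>i. effdom (g i))"

definition objective ::
  "('m \<Rightarrow> 'a \<Rightarrow> ereal) \<Rightarrow> ('m \<Rightarrow> 'a \<Rightarrow> real) \<Rightarrow> 'm \<Rightarrow> 'a \<Rightarrow> ereal" where
  "objective g h i x = g i x + ereal (h i x)"

definition pareto_critical ::
  "('m::finite \<Rightarrow> real^'n \<Rightarrow> ereal) \<Rightarrow> ('m \<Rightarrow> real^'n \<Rightarrow> real) \<Rightarrow> real^'n \<Rightarrow> bool" where
  "pareto_critical g h x \<longleftrightarrow>
     x \<in> domG g \<and> (\<forall>d. (MAX i. dir_deriv (objective g h i) x d) \<ge> 0)"

definition continuously_diff_with_gradient ::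
  "(real^'n \<Rightarrow> real) \<Rightarrow> (real^'n \<Rightarrow> real^'n) \<Rightarrow> bool" where
  "continuously_diff_with_gradient f df \<longleftrightarrow>
     (\<forall>x. GDERIV f x :> df x) \<and> continuous_on UNIV df"

definition holder_on :: "'a set \<Rightarrow> ('a::real_normed_vector \<Rightarrow> 'a) \<Rightarrow> real \<Rightarrow> real \<Rightarrow> bool" where
  "holder_on S df \<nu> C \<longleftrightarrow>
     (\<forall>x\<in>S. \<forall>y\<in>S. norm (df x - df y) \<le> C * norm (x - y) powr \<nu>)"

subsection \<open>Gap function and algorithm\<close>

definition gap_model ::
  "('m::finite \<Rightarrow> real^'n \<Rightarrow> ereal) \<Rightarrow> ('m \<Rightarrow> real^'n \<Rightarrow> real^'n) \<Rightarrow> real^'n \<Rightarrow> real^'n \<Rightarrow> ereal" where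
  "gap_model g dh x u = (MAX i. g i u - g i x + ereal (dh i x \<bullet> (u - x)))"

text \<open>The infimum is attained as soon as a minimizer in the sense of \<open>gap_minimizer\<close> exists;
  for \<open>x\<close> in the domain the value is then a nonpositive real number.\<close>

definition gap ::
  "('m::finite \<Rightarrow> real^'n \<Rightarrow> ereal) \<Rightarrow> ('m \<Rightarrow> real^'n \<Rightarrow> real^'n) \<Rightarrow> real^'n \<Rightarrow> ereal" where
  "gap g dh x = (INF u. gap_model g dh x u)"

definition gap_minimizer ::
  "('m::finite \<Rightarrow> real^'n \<Rightarrow> ereal) \<Rightarrow> ('m \<Rightarrow> real^'n \<Rightarrow> real^'n) \<Rightarrow> real^'n \<Rightarrow> real^'n \<Rightarrow> bool" where
  "gap_minimizer g dh x u \<longleftrightarrow> u \<in> domG g \<and> (\<forall>v. gap_model g dh x u \<le> gap_model g dh x v)"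

definition condg_step ::
  "('m::finite \<Rightarrow> real^'n \<Rightarrow> ereal) \<Rightarrow> ('m \<Rightarrow> real^'n \<Rightarrow> real^'n) \<Rightarrow> real \<Rightarrow> real
     \<Rightarrow> (real^'n \<Rightarrow> real^'n) \<Rightarrow> real^'n \<Rightarrow> real" where
  "condg_step g dh \<nu> M s x =
     min 1 ((\<bar>real_of_ereal (gap g dh x)\<bar> / (M * norm (s x - x) powr (1 + \<nu>))) powr (1 / \<nu>))"

text \<open>Infinite runs of the algorithm: the stopping test never succeeds.\<close>

definition condg_sequence ::
  "('m::finite \<Rightarrow> real^'n \<Rightarrow> ereal) \<Rightarrow> ('m \<Rightarrow> real^'n \<Rightarrow> real^'n) \<Rightarrow> real \<Rightarrow> real
     \<Rightarrow> (real^'n \<Rightarrow> real^'n) \<Rightarrow> (nat \<Rightarrow> real^'n) \<Rightarrow> bool" where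
  "condg_sequence g dh \<nu> M s x \<longleftrightarrow>
     x 0 \<in> domG g \<and>
     (\<forall>k. gap g dh (x k) \<noteq> 0 \<and>
          x (Suc k) = x k + condg_step g dh \<nu> M s (x k) *\<^sub>R (s (x k) - x k))"

text \<open>Limit points of a sequence are limits of subsequences. This differs from \<open>islimpt\<close> on the
  range, which would not count values that are merely repeated infinitely often.\<close>

definition seq_limit_point :: "(nat \<Rightarrow> 'a::topological_space) \<Rightarrow> 'a \<Rightarrow> bool" where
  "seq_limit_point x l \<longleftrightarrow> (\<exists>r::nat \<Rightarrow> nat. strict_mono r \<and> (x \<circ> r) \<longlonglongrightarrow> l)"

end

theory Submission
  imports Defs
begin

text \<open>By the Hoelder descent inequality and the choice of the step size, every \<open>f\<^sub>i\<close> decreases by at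
  least \<open>\<nu> / (1 + \<nu>) * (t\<^sub>k * \<bar>\<theta>(x\<^sub>k)\<bar>)\<close> in step \<open>k\<close>. The \<open>f\<^sub>i\<close> are bounded below on the
  compact domain, so \<open>t\<^sub>k * \<theta>(x\<^sub>k)\<close> tends to zero, and since \<open>t\<^sub>k\<close> stays away from zero while
  \<open>\<bar>\<theta>(x\<^sub>k)\<bar>\<close> does, \<open>\<theta>(x\<^sub>k)\<close> tends to zero. Lower semicontinuity of the \<open>g\<^sub>i\<close> alone makes the
  model \<open>x \<mapsto> max\<^sub>i (g\<^sub>i(u) - g\<^sub>i(x) + \<langle>\<nabla>h\<^sub>i(x), u - x\<rangle>)\<close> upper semicontinuous for fixed \<open>u\<close>, so it is
  nonnegative at every limit point. A direction along which all directional derivatives are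
  negative would violate this, because difference quotients of convex functions are monotone.\<close>


section \<open>Descent inequality for Hoelder continuous gradients\<close>

lemma GDERIV_along_line:
  assumes "GDERIV f (x + t *\<^sub>R d) :> v"
  shows "((\<lambda>t. f (x + t *\<^sub>R d)) has_real_derivative v \<bullet> d) (at t)"
proof -
  have "((\<lambda>t. x + t *\<^sub>R d) has_derivative (\<lambda>h. h *\<^sub>R d)) (at t)"
    by (auto intro!: derivative_eq_intros)
  moreover have "(f has_derivative (\<lambda>h. v \<bullet> h)) (at (x + t *\<^sub>R d))"
    using assms by (simp add: gderiv_def inner_commute)
  ultimately have "((\<lambda>t. f (x + t *\<^sub>R d)) has_derivative (\<lambda>h. v \<bullet> (h *\<^sub>R d))) (at t)"
    by (rule has_derivative_compose)
  moreover have "(\<lambda>h. v \<bullet> (h *\<^sub>R d)) = (*) (v \<bullet> d)"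
    by (auto simp: fun_eq_iff)
  ultimately show ?thesis
    by (simp add: has_field_derivative_def)
qed

text \<open>The linearization and the Hoelder term are subtracted from \<open>f\<close> along the
  segment. The derivative of the resulting \<open>\<phi>\<close> is nonpositive by Cauchy-Schwarz
  and the Hoelder bound between \<open>x\<close> and a point of the segment, which lies in
  \<open>S\<close> by convexity; the claim is \<open>\<phi> 1 \<le> \<phi> 0\<close>.\<close>

lemma holder_descent:
  fixes f :: "'a::real_inner \<Rightarrow> real"
  assumes grad: "\<And>z. GDERIV f z :> df z" and holder: "holder_on S df \<nu> C"
    and "convex S" and x: "x \<in> S" and y: "y \<in> S" and nu: "0 < \<nu>"
  shows "f y \<le> f x + df x \<bullet> (y - x) + C / (1 + \<nu>) * norm (y - x) powr (1 + \<nu>)"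
proof -
  define N where "N = norm (y - x)"
  define \<phi> where "\<phi> t = f (x + t *\<^sub>R (y - x)) - t * (df x \<bullet> (y - x))
    - C / (1 + \<nu>) * N powr (1 + \<nu>) * t powr (1 + \<nu>)" for t
  have der_f: "((\<lambda>t. f (x + t *\<^sub>R (y - x))) has_real_derivative
      df (x + t *\<^sub>R (y - x)) \<bullet> (y - x)) (at t)" for t
    by (rule GDERIV_along_line) (rule grad)
  \<comment> \<open>Derivatives are taken on the open interval only, where the base of
    \<open>powr\<close> is positive; at the endpoints continuity is enough.\<close>
  have "\<phi> 1 \<le> \<phi> 0"
  proof (rule DERIV_nonpos_imp_decreasing_open[where f = \<phi> and a = 0 and b = 1])
    fix t :: real assume t: "0 < t" "t < 1"
    define z where "z = x + t *\<^sub>R (y - x)"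
    have z: "z \<in> S"
      using convexD[OF \<open>convex S\<close> x y, of "1 - t" t] t
      by (simp add: z_def algebra_simps)
    have "(df z - df x) \<bullet> (y - x) \<le> norm (df z - df x) * N"
      unfolding N_def by (rule norm_cauchy_schwarz)
    also have "\<dots> \<le> (C * (t * N) powr \<nu>) * N"
    proof (rule mult_right_mono)
      show "norm (df z - df x) \<le> C * (t * N) powr \<nu>"
        using holder z x t unfolding holder_on_def by (force simp: z_def N_def)
    qed (simp add: N_def)
    also have "\<dots> = C * N powr (1 + \<nu>) * t powr \<nu>"
      using t by (simp add: powr_mult powr_add N_def)
    finally have "(df z - df x) \<bullet> (y - x) - C * N powr (1 + \<nu>) * t powr \<nu> \<le> 0" by simp
    moreover have "(\<phi> has_real_derivative
        (df z - df x) \<bullet> (y - x) - C * N powr (1 + \<nu>) * t powr \<nu>) (at t)"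
      unfolding \<phi>_def z_def using t nu
      by (auto intro!: derivative_eq_intros der_f simp: inner_diff_left)
    ultimately show "\<exists>D. DERIV \<phi> t :> D \<and> D \<le> 0" by blast
  next
    have "continuous_on {0..1} (\<lambda>t. f (x + t *\<^sub>R (y - x)))"
      using der_f DERIV_isCont continuous_at_imp_continuous_on by blast
    then show "continuous_on {0..1} \<phi>"
      unfolding \<phi>_def using nu
      by (intro continuous_intros continuous_on_powr') auto
  qed simp
  then show ?thesis
    using nu by (simp add: \<phi>_def N_def)
qed

section \<open>Lower semicontinuous functions\<close>

text \<open>\<open>Liminf (at l)\<close> ignores the point \<open>l\<close> itself;
  \<open>c < f l\<close> fills it in and yields a full neighbourhood, so that terms of
  \<open>X\<close> equal to \<open>l\<close> are covered.\<close>

lemma lsc_fun_eventually_gt: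
  fixes f :: "'a::topological_space \<Rightarrow> ereal"
  assumes "lsc_fun f" and "(X \<longlongrightarrow> l) F" and "c < f l"
  shows "\<forall>\<^sub>F n in F. c < f (X n)"
proof -
  have "c < Liminf (at l) f"
    using assms by (auto simp: lsc_fun_def intro: less_le_trans)
  then have "\<forall>\<^sub>F z in nhds l. c < f z"
    using \<open>c < f l\<close> by (auto simp: eventually_nhds_conv_at dest: less_LiminfD)
  then show ?thesis
    using assms(2) unfolding filterlim_iff by blast
qed

text \<open>Otherwise points with values at most \<open>- n\<close> accumulate at some
  \<open>l\<close> by compactness, whereas \<open>f\<close> stays above a real number near
  \<open>l\<close> because \<open>f l\<close> is not \<open>-\<infinity>\<close>.\<close>

lemma lsc_fun_compact_bounded_below:
  fixes f :: "'a::metric_space \<Rightarrow> ereal"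
  assumes lsc: "lsc_fun f" and "compact S" and finite_below: "\<And>z. f z \<noteq> -\<infinity>"
  obtains B :: real where "\<And>z. z \<in> S \<Longrightarrow> ereal B < f z"
proof -
  have "\<exists>B. \<forall>z\<in>S. ereal B < f z"
  proof (rule ccontr)
    assume "\<not> ?thesis"
    then have "\<forall>n::nat. \<exists>z\<in>S. f z \<le> ereal (- real n)"
      by (meson not_le)
    then obtain Y where Y: "\<And>n::nat. Y n \<in> S" "\<And>n. f (Y n) \<le> ereal (- real n)"
      by metis
    obtain l r where r: "strict_mono r" "(Y \<circ> r) \<longlonglongrightarrow> l"
      using \<open>compact S\<close> Y(1) unfolding compact_def by metis
    obtain c :: real where c: "ereal c < f l"
      using finite_below[of l] ereal_dense2[of "-\<infinity>" "f l"] by auto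
    have "\<forall>\<^sub>F n in sequentially. ereal c < f ((Y \<circ> r) n)"
      using lsc_fun_eventually_gt[OF lsc r(2) c] .
    moreover have "\<forall>\<^sub>F n in sequentially. - c < real n"
      using eventually_gt_at_top filterlim_real_sequentially
      by (metis filterlim_at_top_dense)
    ultimately have "\<forall>\<^sub>F n in sequentially. False"
    proof eventually_elim
      case (elim n)
      have "ereal c < ereal (- real (r n))"
        using elim(1) Y(2)[of "r n"] unfolding o_def by (rule less_le_trans)
      then show False
        using elim(2) seq_suble[OF r(1), of n] by simp
    qed
    then show False by simp
  qed
  then show ?thesis using that by blast
qed

section \<open>Difference quotients and directional derivatives\<close>

text \<open>The nearer point is the convex combination of \<open>x\<close> and the farther one with
  weight \<open>r / r'\<close>. Two immediate cases are split off: \<open>r = r'\<close>, whose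
  weight 1 is outside the range of \<open>convex_fun\<close>, and an infinite value at the farther
  point.\<close>

lemma convex_fun_difference_quotient_mono:
  fixes f :: "'a::real_vector \<Rightarrow> ereal"
  assumes cvx: "convex_fun f" and a: "f x = ereal a" and r: "0 < r" "r \<le> r'"
    and fin: "\<And>z. f z \<noteq> -\<infinity>"
  shows "(f (x + r *\<^sub>R d) - f x) / ereal r \<le> (f (x + r' *\<^sub>R d) - f x) / ereal r'"
proof (cases "r = r' \<or> f (x + r' *\<^sub>R d) = \<infinity>")
  case True
  then show ?thesis using a r by (auto simp: ereal_divide_eq)
next
  case False
  define t where "t = r / r'"
  have t: "0 < t" "t < 1" "r = t * r'" "0 < r'" using False r by (auto simp: t_def)
  obtain b where b: "f (x + r' *\<^sub>R d) = ereal b"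
    using False fin by (metis ereal_cases)
  have "(1 - t) *\<^sub>R x + t *\<^sub>R (x + r' *\<^sub>R d) = x + r *\<^sub>R d"
    by (simp add: t algebra_simps)
  then have "f (x + r *\<^sub>R d) \<le> ereal (1 - t) * f x + ereal t * f (x + r' *\<^sub>R d)"
    using cvx t unfolding convex_fun_def by metis
  then have le: "f (x + r *\<^sub>R d) \<le> ereal ((1 - t) * a + t * b)"
    by (simp add: a b)
  then obtain c where c: "f (x + r *\<^sub>R d) = ereal c"
    using fin by (metis ereal_cases ereal_infty_less_eq(1) MInfty_neq_ereal(1) PInfty_neq_ereal(1))
  have "c - a \<le> t * (b - a)" using le c by (simp add: algebra_simps)
  then have "(c - a) / (t * r') \<le> (t * (b - a)) / (t * r')"
    using t by (intro divide_right_mono) auto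
  then have "(c - a) / r \<le> (b - a) / r'" using t by simp
  then show ?thesis using r by (simp add: a b c)
qed

text \<open>A quotient that is monotone in the step converges to its infimum as the step shrinks; in
  the extended reals this includes infinite limits.\<close>

lemma convex_fun_difference_quotient_tendsto:
  fixes f :: "'a::real_vector \<Rightarrow> ereal"
  assumes "convex_fun f" and "f x = ereal a" and "\<And>z. f z \<noteq> -\<infinity>"
  shows "((\<lambda>r. (f (x + r *\<^sub>R d) - f x) / ereal r)
    \<longlongrightarrow> (INF r\<in>{0<..}. (f (x + r *\<^sub>R d) - f x) / ereal r)) (at_right 0)"
proof (rule order_tendstoI)
  fix c assume "c < (INF r\<in>{0<..}. (f (x + r *\<^sub>R d) - f x) / ereal r)"
  then have "\<And>r. 0 < r \<Longrightarrow> c < (f (x + r *\<^sub>R d) - f x) / ereal r"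
    by (meson INF_lower greaterThan_iff less_le_trans)
  then show "\<forall>\<^sub>F r in at_right 0. c < (f (x + r *\<^sub>R d) - f x) / ereal r"
    by (simp add: eventually_at_right_less eventually_mono[OF eventually_at_right_less])
next
  fix c assume "(INF r\<in>{0<..}. (f (x + r *\<^sub>R d) - f x) / ereal r) < c"
  then obtain r' where r': "0 < r'" "(f (x + r' *\<^sub>R d) - f x) / ereal r' < c"
    by (auto simp: INF_less_iff)
  have "\<forall>\<^sub>F r in at_right 0. 0 < r \<and> r < r'"
    using r'(1) by (auto simp: eventually_at_right)
  then show "\<forall>\<^sub>F r in at_right 0. (f (x + r *\<^sub>R d) - f x) / ereal r < c"
  proof eventually_elim
    case (elim r)
    then show ?case
      using convex_fun_difference_quotient_mono[OF assms(1,2) _ _ assms(3), of r r' d] r'(2)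
      by (auto intro: le_less_trans)
  qed
qed

text \<open>This justifies the \<open>Lim\<close> in \<open>dir_deriv\<close>: the convex part has a
  limit in the extended reals and the differentiable part a finite one, so the sum of the limits is
  never of the form \<open>\<infinity> - \<infinity>\<close>.\<close>

lemma dir_deriv_convex_plus_differentiable:
  fixes f :: "'a::real_inner \<Rightarrow> ereal"
  assumes cvx: "convex_fun f" and a: "f x = ereal a" and fin: "\<And>z. f z \<noteq> -\<infinity>"
    and grad: "GDERIV k x :> v"
  shows "dir_deriv (\<lambda>z. f z + ereal (k z)) x d
    = (INF r\<in>{0<..}. (f (x + r *\<^sub>R d) - f x) / ereal r) + ereal (v \<bullet> d)"
proof -
  have "((\<lambda>r. k (x + r *\<^sub>R d)) has_real_derivative v \<bullet> d) (at 0)"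
    by (rule GDERIV_along_line) (simp add: grad)
  then have "((\<lambda>r. (k (x + r *\<^sub>R d) - k x) / r) \<longlongrightarrow> v \<bullet> d) (at_right 0)"
    by (auto simp: DERIV_def intro: tendsto_within_subset)
  then have k: "((\<lambda>r. ereal ((k (x + r *\<^sub>R d) - k x) / r)) \<longlongrightarrow> ereal (v \<bullet> d)) (at_right 0)"
    by simp
  have "((\<lambda>r. (f (x + r *\<^sub>R d) - f x) / ereal r + ereal ((k (x + r *\<^sub>R d) - k x) / r))
    \<longlongrightarrow> (INF r\<in>{0<..}. (f (x + r *\<^sub>R d) - f x) / ereal r) + ereal (v \<bullet> d)) (at_right 0)"
    by (rule tendsto_add_ereal_general[OF _ convex_fun_difference_quotient_tendsto[OF cvx a fin] k])
      auto
  moreover have "\<forall>\<^sub>F r in at_right 0.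
      (f (x + r *\<^sub>R d) - f x) / ereal r + ereal ((k (x + r *\<^sub>R d) - k x) / r)
      = (f (x + r *\<^sub>R d) + ereal (k (x + r *\<^sub>R d)) - (f x + ereal (k x))) / ereal r"
    using eventually_at_right_less[of 0]
  proof eventually_elim
    case (elim r)
    show ?case
      using elim fin[of "x + r *\<^sub>R d"]
      by (cases "f (x + r *\<^sub>R d)") (auto simp: a field_simps)
  qed
  ultimately show ?thesis
    unfolding dir_deriv_def by (intro tendsto_Lim) (auto elim: Lim_transform_eventually)
qed


section \<open>Gap function and Pareto criticality\<close>

lemma domG_real_of_ereal:
  assumes "\<And>i. proper_fun (g i)" and "x \<in> domG g"
  shows "g i x = ereal (real_of_ereal (g i x))"
proof -
  have "g i x < \<infinity>" using assms(2) by (auto simp: domG_def effdom_def)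
  moreover have "g i x \<noteq> -\<infinity>" using assms(1) by (simp add: proper_fun_def)
  ultimately show ?thesis by (cases "g i x") auto
qed

text \<open>A negative directional derivative means that some difference quotient of
  \<open>g i\<close> lies below \<open>- (dh i x \<bullet> d)\<close>. A step that achieves this for
  all \<open>i\<close> at once makes the model negative.\<close>

lemma stationary_imp_pareto_critical:
  fixes g :: "'m::finite \<Rightarrow> real^'n \<Rightarrow> ereal"
  assumes proper: "\<And>i. proper_fun (g i)" and cvx: "\<And>i. convex_fun (g i)"
    and grad: "\<And>i. GDERIV (h i) x :> dh i x"
    and x: "x \<in> domG g" and nonneg: "\<And>u. 0 \<le> gap_model g dh x u"
  shows "pareto_critical g h x"
proof -
  have fin: "g i z \<noteq> -\<infinity>" for i z using proper by (simp add: proper_fun_def)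
  note gx = domG_real_of_ereal[OF proper x]
  define a where "a i = real_of_ereal (g i x)" for i
  have a: "g i x = ereal (a i)" for i unfolding a_def by (rule gx)
  have "0 \<le> (MAX i. dir_deriv (objective g h i) x d)" for d
  proof (rule ccontr)
    assume "\<not> ?thesis"
    then have neg: "dir_deriv (objective g h i) x d < 0" for i
      using Max_less_iff[of "range (\<lambda>i. dir_deriv (objective g h i) x d)" 0] by (auto simp: not_le)
    define q where "q i r = (g i (x + r *\<^sub>R d) - g i x) / ereal r" for i r
    have "\<exists>r>0. q i r < ereal (- (dh i x \<bullet> d))" for i
    proof -
      have "(INF r\<in>{0<..}. q i r) + ereal (dh i x \<bullet> d) < 0"
        using neg[of i] dir_deriv_convex_plus_differentiable[OF cvx a fin grad, where d = d]
        by (simp add: objective_def[abs_def] q_def)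
      then have "(INF r\<in>{0<..}. q i r) < ereal (- (dh i x \<bullet> d))"
        by (cases "INF r\<in>{0<..}. q i r") auto
      then show ?thesis by (auto simp: INF_less_iff)
    qed
    then obtain R where R: "\<And>i. R i > 0" "\<And>i. q i (R i) < ereal (- (dh i x \<bullet> d))"
      by metis
    \<comment> \<open>Quotients do not increase when the step shrinks, so the smallest of the
      finitely many steps serves every \<open>i\<close>.\<close>
    define r where "r = Min (range R)"
    have r: "0 < r" "r \<le> R i" for i using R(1) by (auto simp: r_def)
    have "g i (x + r *\<^sub>R d) - g i x + ereal (dh i x \<bullet> (x + r *\<^sub>R d - x)) < 0" for i
    proof -
      have "q i r < ereal (- (dh i x \<bullet> d))"
        using convex_fun_difference_quotient_mono[OF cvx a r fin, of i d] R(2)[of i]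
        unfolding q_def by (rule le_less_trans)
      then show ?thesis
        using r(1) fin[of i "x + r *\<^sub>R d"] unfolding q_def
        by (cases "g i (x + r *\<^sub>R d)") (auto simp: a field_simps)
    qed
    then have "gap_model g dh x (x + r *\<^sub>R d) < 0"
      unfolding gap_model_def by (subst Max_less_iff) auto
    then show False using nonneg[of "x + r *\<^sub>R d"] by simp
  qed
  then show ?thesis using x by (simp add: pareto_critical_def)
qed

text \<open>The value of \<open>g i\<close> at the moving point enters with a minus sign, so its
  lower semicontinuity bounds the model from above. A \<open>u\<close> with negative model at
  \<open>l\<close> would push the model at some \<open>X n\<close> strictly below the gap, which is
  its infimum.\<close>

lemma gap_model_nonneg_at_limit:
  fixes g :: "'m::finite \<Rightarrow> real^'n \<Rightarrow> ereal"
  assumes proper: "\<And>i. proper_fun (g i)" and lsc: "\<And>i. lsc_fun (g i)"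
    and cont: "\<And>i. isCont (dh i) l"
    and X: "X \<longlonglongrightarrow> l" "\<And>n. X n \<in> domG g" and l: "l \<in> domG g"
    and gap: "\<And>n. gap g dh (X n) = ereal (- \<theta> n)" and \<theta>: "\<theta> \<longlonglongrightarrow> 0"
  shows "0 \<le> gap_model g dh l u"
proof (rule ccontr)
  define a where "a i z = real_of_ereal (g i z)" for i z
  have a: "g i z = ereal (a i z)" if "z \<in> domG g" for i z
    unfolding a_def using domG_real_of_ereal[OF proper that] .
  assume "\<not> ?thesis"
  then have neg: "g i u - g i l + ereal (dh i l \<bullet> (u - l)) < 0" for i
    unfolding gap_model_def not_le by (subst (asm) Max_less_iff) auto
  have "u \<in> domG g"
  proof -
    have "g i u \<noteq> \<infinity>" for i using neg[of i] by (auto simp: a[OF l])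
    then show ?thesis by (auto simp: domG_def effdom_def less_top)
  qed
  note au = a[OF this]
  have "\<forall>\<^sub>F n in sequentially. a i u - a i (X n) + dh i (X n) \<bullet> (u - X n) < - \<theta> n" for i
  proof -
    \<comment> \<open>The limit expression equals \<open>- 3 * e\<close>. The gradient term and
      \<open>g i (X n)\<close> each cost less than \<open>e\<close>, which leaves a value below
      \<open>- e\<close>, and \<open>- e\<close> is below \<open>- \<theta> n\<close>.\<close>
    define e where "e = - (a i u - a i l + dh i l \<bullet> (u - l)) / 3"
    have e: "e > 0" using neg[of i] by (simp add: e_def au a[OF l])
    have "(\<lambda>n. dh i (X n)) \<longlonglongrightarrow> dh i l"
      using cont X(1) by (rule isCont_tendsto_compose)
    then have "(\<lambda>n. dh i (X n) \<bullet> (u - X n)) \<longlonglongrightarrow> dh i l \<bullet> (u - l)"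
      by (intro tendsto_intros X(1))
    then have "\<forall>\<^sub>F n in sequentially. dh i (X n) \<bullet> (u - X n) < dh i l \<bullet> (u - l) + e"
      using e by (intro order_tendstoD) auto
    moreover have "\<forall>\<^sub>F n in sequentially. \<theta> n < e"
      using \<theta> e by (rule order_tendstoD)
    moreover have "\<forall>\<^sub>F n in sequentially. ereal (a i l - e) < g i (X n)"
      using e by (intro lsc_fun_eventually_gt[OF lsc X(1)]) (simp add: a[OF l])
    ultimately show ?thesis
      by eventually_elim (use e_def in \<open>simp add: a X(2) field_simps\<close>)
  qed
  \<comment> \<open>Finitely many objectives share one index \<open>n\<close>.\<close>
  then have "\<forall>\<^sub>F n in sequentially. \<forall>i. a i u - a i (X n) + dh i (X n) \<bullet> (u - X n) < - \<theta> n"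
    by (simp add: eventually_all_finite)
  then obtain n where n: "\<And>i. a i u - a i (X n) + dh i (X n) \<bullet> (u - X n) < - \<theta> n"
    by (auto simp: eventually_sequentially)
  have "gap_model g dh (X n) u < ereal (- \<theta> n)"
    unfolding gap_model_def by (subst Max_less_iff) (use n in \<open>auto simp: au a X(2)\<close>)
  moreover have "gap g dh (X n) \<le> gap_model g dh (X n) u"
    unfolding gap_def by (rule INF_lower) simp
  ultimately show False by (simp add: gap)
qed

text \<open>Passage from the extended-real gap to real arithmetic: the minimizer attains the
  infimum, and on \<open>domG g\<close> the model is a maximum of finitely many reals. The model
  value 0 at \<open>x\<close> gives the sign of \<open>\<theta>\<close> and the case
  \<open>u = x\<close>.\<close>

lemma gap_minimizer_real:
  fixes g :: "'m::finite \<Rightarrow> real^'n \<Rightarrow> ereal"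
  assumes proper: "\<And>i. proper_fun (g i)" and x: "x \<in> domG g" and min: "gap_minimizer g dh x u"
  obtains \<theta> where "0 \<le> \<theta>" "gap g dh x = ereal (- \<theta>)" "u = x \<Longrightarrow> \<theta> = 0"
    "\<And>i. real_of_ereal (g i u) - real_of_ereal (g i x) + dh i x \<bullet> (u - x) \<le> - \<theta>"
proof -
  define a where "a i z = real_of_ereal (g i z)" for i z
  have a: "g i z = ereal (a i z)" if "z \<in> domG g" for i z
    unfolding a_def using domG_real_of_ereal[OF proper that] .
  have u: "u \<in> domG g" using min by (simp add: gap_minimizer_def)
  have "gap_model g dh x u \<le> gap g dh x"
    using min unfolding gap_def gap_minimizer_def by (intro INF_greatest) auto
  moreover have le: "gap g dh x \<le> gap_model g dh x v" for v
    unfolding gap_def by (rule INF_lower) simp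
  ultimately have gap: "gap g dh x = gap_model g dh x u" by (simp add: order_antisym)
  have model: "gap_model g dh x z = (MAX i. ereal (a i z - a i x + dh i x \<bullet> (z - x)))"
    if "z \<in> domG g" for z
    unfolding gap_model_def by (simp add: a x that)
  have model_x: "gap_model g dh x x = 0" by (simp add: model x zero_ereal_def)
  have "gap g dh x \<in> range (\<lambda>i. ereal (a i u - a i x + dh i x \<bullet> (u - x)))"
    unfolding gap model[OF u] by (intro Max_in) auto
  then obtain t where t: "gap g dh x = ereal t" by auto
  show ?thesis
  proof (rule that[of "- t"])
    show "0 \<le> - t" using le[of x] by (simp add: model_x t)
    show "gap g dh x = ereal (- (- t))" by (simp add: t)
    show "u = x \<Longrightarrow> - t = 0" using gap t model_x by simp
    fix i
    have "ereal (a i u - a i x + dh i x \<bullet> (u - x)) \<le> ereal t"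
      unfolding t[symmetric] gap model[OF u] by (rule Max_ge) auto
    then show "real_of_ereal (g i u) - real_of_ereal (g i x) + dh i x \<bullet> (u - x) \<le> - (- t)"
      by (simp add: a_def)
  qed
qed

section \<open>A single step of the algorithm\<close>

text \<open>\<open>convex_fun\<close> speaks of \<open>0 < t < 1\<close> only; the endpoints are
  added because full steps \<open>t = 1\<close> can occur.\<close>

lemma convex_fun_segment_le:
  assumes "convex_fun f" "f x = ereal a" "f y = ereal b" "0 \<le> t" "t \<le> 1"
  shows "f ((1 - t) *\<^sub>R x + t *\<^sub>R y) \<le> ereal ((1 - t) * a + t * b)"
proof (cases "t = 0 \<or> t = 1")
  case True
  then show ?thesis using assms by auto
next
  case False
  then have "0 < t \<and> t < 1" using assms by auto
  then have "f ((1 - t) *\<^sub>R x + t *\<^sub>R y) \<le> ereal (1 - t) * f x + ereal t * f y"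
    using assms unfolding convex_fun_def by blast
  then show ?thesis using assms by simp
qed

text \<open>Convexity of \<open>g i\<close> and the gap value give a first-order decrease of
  \<open>t * \<theta>\<close>. The step size keeps the Hoelder remainder below
  \<open>t * \<theta> / (1 + \<nu>)\<close>, so the fraction \<open>\<nu> / (1 + \<nu>)\<close>
  survives.\<close>

lemma condg_step_decrease:
  fixes g :: "'m::finite \<Rightarrow> real^'n \<Rightarrow> ereal"
  assumes proper: "\<And>i. proper_fun (g i)" and cvx: "\<And>i. convex_fun (g i)"
    and grad: "\<And>z. GDERIV (h i) z :> dh i z" and domG: "convex (domG g)"
    and nu: "0 < \<nu>" and M: "0 < M" and holder: "holder_on (domG g) (dh i) \<nu> M"
    and x: "x \<in> domG g" and min: "gap_minimizer g dh x (s x)"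
    and t: "t = condg_step g dh \<nu> M s x" and y: "y = x + t *\<^sub>R (s x - x)"
    and \<theta>: "\<theta> = \<bar>real_of_ereal (gap g dh x)\<bar>"
  shows "y \<in> domG g"
    and "real_of_ereal (g i y) + h i y
      \<le> real_of_ereal (g i x) + h i x - \<nu> / (1 + \<nu>) * (t * \<theta>)"
proof -
  define a where "a z = real_of_ereal (g i z)" for z
  have a: "g i z = ereal (a z)" if "z \<in> domG g" for z
    unfolding a_def using domG_real_of_ereal[OF proper that] .
  have s: "s x \<in> domG g" using min by (simp add: gap_minimizer_def)
  define N where "N = norm (s x - x)"
  define A where "A = \<theta> / (M * N powr (1 + \<nu>))"
  have \<theta>_nonneg: "0 \<le> \<theta>" unfolding \<theta> by (rule abs_ge_zero)
  then have A: "0 \<le> A" using M by (simp add: A_def)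
  have t_eq: "t = min 1 (A powr (1 / \<nu>))" by (simp add: t condg_step_def A_def N_def \<theta>)
  then have t01: "0 \<le> t" "t \<le> 1" by auto
  have y': "y = (1 - t) *\<^sub>R x + t *\<^sub>R s x" by (simp add: y algebra_simps)
  show yG: "y \<in> domG g"
    unfolding y' using domG x s t01 by (intro convexD) auto
  \<comment> \<open>This is \<open>t \<le> A powr (1 / \<nu>)\<close> raised to the power
    \<open>\<nu>\<close>. For \<open>N = 0\<close> the left side vanishes since
    \<open>0 powr (1 + \<nu>) = 0\<close>.\<close>
  have tN: "M * (N powr (1 + \<nu>) * t powr \<nu>) \<le> \<theta>"
  proof (cases "N = 0")
    case True
    then show ?thesis by (simp add: \<theta>_nonneg)
  next
    case False
    have "t powr \<nu> \<le> (A powr (1 / \<nu>)) powr \<nu>"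
      using t01 nu t_eq by (intro powr_mono2) auto
    then have "t powr \<nu> \<le> A" using A nu by (simp add: powr_powr)
    then show ?thesis
      using M False by (simp add: A_def N_def field_simps)
  qed
  obtain \<theta>' where \<theta>': "0 \<le> \<theta>'" "gap g dh x = ereal (- \<theta>')"
    "a (s x) - a x + dh i x \<bullet> (s x - x) \<le> - \<theta>'"
    using gap_minimizer_real[OF proper x min] unfolding a_def by metis
  then have "\<theta>' = \<theta>" by (simp add: \<theta>)
  have "ereal (a y) \<le> ereal ((1 - t) * a x + t * a (s x))"
    using convex_fun_segment_le[OF cvx a[OF x] a[OF s] t01] yG by (simp add: a y')
  then have g_le: "a y \<le> a x + t * (a (s x) - a x)" by (simp add: algebra_simps)
  have "h i y \<le> h i x + dh i x \<bullet> (y - x) + M / (1 + \<nu>) * norm (y - x) powr (1 + \<nu>)"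
    by (rule holder_descent[OF grad holder domG x yG nu])
  also have "dh i x \<bullet> (y - x) = t * (dh i x \<bullet> (s x - x))" by (simp add: y)
  \<comment> \<open>One factor \<open>t\<close> is split off from \<open>t powr (1 + \<nu>)\<close>,
    so that \<open>tN\<close> bounds the rest.\<close>
  also have "M / (1 + \<nu>) * norm (y - x) powr (1 + \<nu>)
      = t * (M * (N powr (1 + \<nu>) * t powr \<nu>)) / (1 + \<nu>)"
    using t01 by (simp add: y N_def powr_mult powr_add)
  also have "\<dots> \<le> t * \<theta> / (1 + \<nu>)"
    using tN t01 nu by (intro divide_right_mono mult_left_mono) auto
  finally have "a y + h i y \<le> a x + h i x
      + t * (a (s x) - a x + dh i x \<bullet> (s x - x)) + t * \<theta> / (1 + \<nu>)"
    using g_le by (simp add: algebra_simps)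
  also have "t * (a (s x) - a x + dh i x \<bullet> (s x - x)) \<le> t * (- \<theta>)"
    using \<theta>'(3) t01 \<open>\<theta>' = \<theta>\<close> by (intro mult_left_mono) auto
  also have "a x + h i x + t * (- \<theta>) + t * \<theta> / (1 + \<nu>) = a x + h i x - \<nu> / (1 + \<nu>) * (t * \<theta>)"
    using nu by (simp add: field_simps)
  finally show "real_of_ereal (g i y) + h i y
      \<le> real_of_ereal (g i x) + h i x - \<nu> / (1 + \<nu>) * (t * \<theta>)"
    by (simp add: a_def)
qed

text \<open>The step rule grows with the gap and shrinks with the distance.
  \<open>s x \<noteq> x\<close> makes the denominator positive; for \<open>s x = x\<close>, division
  by zero would give step 0.\<close>

lemma condg_step_lower_bound:
  assumes "0 < \<nu>" "0 < M" "s x \<noteq> x" "norm (s x - x) \<le> D" "0 < e"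
    "e \<le> \<bar>real_of_ereal (gap g dh x)\<bar>"
  shows "min 1 ((e / (M * D powr (1 + \<nu>))) powr (1 / \<nu>)) \<le> condg_step g dh \<nu> M s x"
  unfolding condg_step_def using assms
  by (intro min.mono order_refl powr_mono2 frac_le mult_left_mono mult_pos_pos) auto

text \<open>Being decreasing and bounded below, \<open>\<phi>\<close> converges; its consecutive
  differences therefore vanish in the limit, and they dominate \<open>a\<close>.\<close>

lemma telescoping_decrease_tendsto_0:
  fixes \<phi> a :: "nat \<Rightarrow> real"
  assumes dec: "\<And>k. \<phi> (Suc k) \<le> \<phi> k - a k" and a: "\<And>k. 0 \<le> a k" and B: "\<And>k. B \<le> \<phi> k"
  shows "a \<longlonglongrightarrow> 0"
proof -
  have "decseq \<phi>" using dec a by (intro decseq_SucI) (smt (verit))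
  then obtain L where L: "\<phi> \<longlonglongrightarrow> L" using decseq_convergent B by metis
  then have "(\<lambda>k. \<phi> k - \<phi> (Suc k)) \<longlonglongrightarrow> L - L"
    by (intro tendsto_diff LIMSEQ_Suc)
  then have "(\<lambda>k. \<phi> k - \<phi> (Suc k)) \<longlonglongrightarrow> 0" by simp
  then show ?thesis
    by (rule tendsto_sandwich[OF _ _ tendsto_const, rotated 2])
      (use dec a in \<open>auto intro!: always_eventually simp: algebra_simps\<close>)
qed

section \<open>Vanishing of the gap and criticality of limit points\<close>

theorem theorem3p4:
  fixes g :: "'m::finite \<Rightarrow> real^'n \<Rightarrow> ereal"
    and h :: "'m \<Rightarrow> real^'n \<Rightarrow> real"
    and dh :: "'m \<Rightarrow> real^'n \<Rightarrow> real^'n"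
    and \<nu> :: real
    and M :: "'m \<Rightarrow> real"
    and s :: "real^'n \<Rightarrow> real^'n"
    and x :: "nat \<Rightarrow> real^'n"
  assumes g_proper: "\<And>i. proper_fun (g i)"
    and g_convex: "\<And>i. convex_fun (g i)"
    and g_lsc: "\<And>i. lsc_fun (g i)"
    and h_C1: "\<And>i. continuously_diff_with_gradient (h i) (dh i)"
    and domG_nonempty: "domG g \<noteq> {}"
    and domG_convex: "convex (domG g)"
    and domG_compact: "compact (domG g)"
    and nu: "0 < \<nu>" "\<nu> \<le> 1"
    and M_pos: "\<And>i. M i > 0"
    and holder: "\<And>i. holder_on (effdom (g i)) (dh i) \<nu> (M i)"
    and s_min: "\<And>y. y \<in> domG g \<Longrightarrow> gap_minimizer g dh y (s y)"
    and x_seq: "condg_sequence g dh \<nu> (MAX i. M i) s x"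
  shows "\<forall>l. seq_limit_point x l \<longrightarrow> pareto_critical g h l"
proof (intro allI impI)
  define C where "C = (MAX i. M i)"
  have C_ge: "M i \<le> C" for i by (simp add: C_def)
  with M_pos have C_pos: "0 < C" by (meson less_le_trans)
  have grad: "GDERIV (h i) z :> dh i z" and cont: "isCont (dh i) z" for i z
    using h_C1[of i] by (auto simp: continuously_diff_with_gradient_def continuous_on_eq_continuous_at)
  have holderC: "holder_on (domG g) (dh i) \<nu> C" for i
    unfolding holder_on_def
  proof (intro ballI)
    fix y z assume "y \<in> domG g" "z \<in> domG g"
    then have "norm (dh i y - dh i z) \<le> M i * norm (y - z) powr \<nu>"
      using holder[of i] by (auto simp: holder_on_def domG_def)
    also have "\<dots> \<le> C * norm (y - z) powr \<nu>" by (intro mult_right_mono C_ge) simp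
    finally show "norm (dh i y - dh i z) \<le> C * norm (y - z) powr \<nu>" .
  qed
  define t where "t k = condg_step g dh \<nu> C s (x k)" for k
  define \<theta> where "\<theta> k = \<bar>real_of_ereal (gap g dh (x k))\<bar>" for k
  have x_Suc: "x (Suc k) = x k + t k *\<^sub>R (s (x k) - x k)" for k
    using x_seq by (simp add: condg_sequence_def t_def C_def)
  \<comment> \<open>Membership of \<open>x k\<close> in the domain stays a premise, because the
    first conclusion drives the induction that establishes it.\<close>
  note step = condg_step_decrease[OF g_proper g_convex grad domG_convex nu(1) C_pos holderC _
      s_min t_def x_Suc \<theta>_def]
  have xG: "x k \<in> domG g" for k
  proof (induction k)
    case 0
    then show ?case using x_seq by (simp add: condg_sequence_def)
  next
    case (Suc k)
    show ?case by (rule step(1)) (rule Suc)+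
  qed
  have gap_eq: "gap g dh (x k) = ereal (- \<theta> k)" and \<theta>_0: "s (x k) = x k \<Longrightarrow> \<theta> k = 0" for k
    using gap_minimizer_real[OF g_proper xG s_min[OF xG], of k] by (force simp: \<theta>_def)+
  have t_nonneg: "0 \<le> t k" and \<theta>_nonneg: "0 \<le> \<theta> k" for k
    by (auto simp: t_def \<theta>_def condg_step_def real_of_ereal_pos)
  have "\<theta> \<longlonglongrightarrow> 0"
  proof -
    \<comment> \<open>The guaranteed decrease is the same for all objectives, so one arbitrary
      objective suffices.\<close>
    fix i :: 'm
    obtain B where B: "\<And>z. z \<in> domG g \<Longrightarrow> ereal B < g i z"
      using lsc_fun_compact_bounded_below[OF g_lsc domG_compact] g_proper
      by (metis proper_fun_def)
    have "continuous_on (domG g) (h i)"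
      using grad has_derivative_continuous
      by (metis gderiv_def continuous_at_imp_continuous_on)
    then have "bounded (h i ` domG g)"
      using domG_compact compact_continuous_image compact_imp_bounded by blast
    then obtain B' where B': "\<And>z. z \<in> domG g \<Longrightarrow> \<bar>h i z\<bar> \<le> B'"
      by (auto simp: bounded_iff)
    have "(\<lambda>k. \<nu> / (1 + \<nu>) * (t k * \<theta> k)) \<longlonglongrightarrow> 0"
    proof (rule telescoping_decrease_tendsto_0)
      show "real_of_ereal (g i (x (Suc k))) + h i (x (Suc k))
          \<le> real_of_ereal (g i (x k)) + h i (x k) - \<nu> / (1 + \<nu>) * (t k * \<theta> k)" for k
        by (rule step(2)) (rule xG)+
      show "0 \<le> \<nu> / (1 + \<nu>) * (t k * \<theta> k)" for k
        using nu t_nonneg \<theta>_nonneg by simp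
      show "B - B' \<le> real_of_ereal (g i (x k)) + h i (x k)" for k
      proof -
        have "ereal B < ereal (real_of_ereal (g i (x k)))"
          using B[OF xG] domG_real_of_ereal[OF g_proper xG] by metis
        then show ?thesis using B'[OF xG, of k] by simp
      qed
    qed
    then have "(\<lambda>k. (1 + \<nu>) / \<nu> * (\<nu> / (1 + \<nu>) * (t k * \<theta> k))) \<longlonglongrightarrow> (1 + \<nu>) / \<nu> * 0"
      by (intro tendsto_mult tendsto_const)
    then have t\<theta>: "(\<lambda>k. t k * \<theta> k) \<longlonglongrightarrow> 0" using nu by simp
    obtain D where D: "\<And>y z. y \<in> domG g \<Longrightarrow> z \<in> domG g \<Longrightarrow> norm (y - z) \<le> D"
      using compact_imp_bounded[OF domG_compact] bounded_two_points by (metis dist_norm)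
    have "\<forall>\<^sub>F k in sequentially. \<theta> k < e" if e: "0 < e" for e
    proof -
      \<comment> \<open>A lower bound for the step size whenever \<open>\<theta> k \<ge> e\<close>.
        Using \<open>max 1 D\<close> in place of \<open>D\<close> keeps the denominator nonzero,
        hence \<open>c\<close> positive, even if the domain is a single point.\<close>
      define c where "c = min 1 ((e / (C * (max 1 D) powr (1 + \<nu>))) powr (1 / \<nu>))"
      have "0 < c" using e C_pos by (simp add: c_def)
      with e have "\<forall>\<^sub>F k in sequentially. t k * \<theta> k < c * e"
        by (intro order_tendstoD(2)[OF t\<theta>]) simp
      then show ?thesis
      proof eventually_elim
        case (elim k)
        show ?case
        proof (rule ccontr)
          assume "\<not> ?case"
          then have \<theta>k: "e \<le> \<theta> k" by simp
          have "s (x k) \<in> domG g" using s_min[OF xG] by (simp add: gap_minimizer_def)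
          \<comment> \<open>Since \<open>\<theta> k \<ge> e > 0\<close>, the case
            \<open>s (x k) = x k\<close> is ruled out by \<open>\<theta>_0\<close>.\<close>
          then have "c \<le> t k"
            unfolding c_def t_def using \<theta>_0[of k] e \<theta>k D[of "s (x k)" "x k"] xG[of k]
            by (intro condg_step_lower_bound nu C_pos) (auto simp: \<theta>_def)
          then have "c * e \<le> t k * \<theta> k"
            using \<theta>k e \<open>0 < c\<close> by (intro mult_mono) auto
          then show False using elim by simp
        qed
      qed
    qed
    then show ?thesis
      using \<theta>_nonneg by (intro order_tendstoI) (auto intro: always_eventually less_le_trans)
  qed
  fix l assume "seq_limit_point x l"
  then obtain r where r: "strict_mono r" "(x \<circ> r) \<longlonglongrightarrow> l" by (auto simp: seq_limit_point_def)
  \<comment> \<open>Compactness makes the domain closed, so the limit point cannot leave it.\<close>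
  have l: "l \<in> domG g"
    using closed_sequentially[OF compact_imp_closed[OF domG_compact] _ r(2)] xG by simp
  have "(\<theta> \<circ> r) \<longlonglongrightarrow> 0" using LIMSEQ_subseq_LIMSEQ[OF \<open>\<theta> \<longlonglongrightarrow> 0\<close> r(1)] .
  then have "0 \<le> gap_model g dh l u" for u
    by (intro gap_model_nonneg_at_limit[OF g_proper g_lsc cont r(2) _ l, where \<theta> = "\<theta> \<circ> r"])
      (simp_all add: xG gap_eq)
  then show "pareto_critical g h l"
    by (rule stationary_imp_pareto_critical[where dh = dh, OF g_proper g_convex grad l])
qed

end
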